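(* Let $G$ be a finitely generated group. The following are equivalent: (i) $G$ admits some virtual homomorphism. (ii) There exist a Banach metric $d$ on $G$ and some $h\in\partial(G,d)$ such that $h$ has a finite orbit $|G.h|<\infty$. Moreover, if $G$ admits a surjective homomorphism onto $\mathbb{Z}$, then there exist a Banach metric $d$ on $G$ and some $h\in\partial(G,d)$ which is a fixed point of $G$, i.e. $x.h=h$ for all $x\in G$.
   Context: Virtual homomorphism: a virtual homomorphism on a group $G$ is a function $\varphi:G\to\mathbb{Z}$ for which there exists a finite index subgroup $H\le G$ such that the restriction $\varphi|_H$ is a non-trivial homomorphism. Cayley metric: for a finite symmetric generating set $S=S^{-1}$ of a group $G$, the Cayley graph has vertex set $G$ and edges $x\sim y\iff x^{-1}y\in S$; $d_S$ is its graph metric (the word metric). Quasi-isometry: metric spaces $(X,d)$, $(Y,\rho)$ are quasi-isometric if there are a map $\varphi:X\to Y$ and $C>0$ such that for every $y\in Y$ there is $x\in X$ with $\rho(\varphi(x),y)\le C$, and $C^{-1}d(x,x')-C\le\rho(\varphi(x),\varphi(x'))\le C\,d(x,x')+C$ for all $x,x'\in X$. Metric-functional boundary: for a metric $d$ on a group $G$ with base point $1$, let $L(G,d)$ be the set of functions $h:G\to\mathbb{R}$ with $h(1)=0$ and $|h(x)-h(y)|\le d(x,y)$ for all $x,y\in G$, with the topology of pointwise convergence. For $x\in G$ let $b_x(y)=d(x,y)-d(x,1)$. Let $\overline{(G,d)}$ be the closure of $\{b_x : x\in G\}$ in $L(G,d)$, and $\partial(G,d)=\overline{(G,d)}\setminus\{b_x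 : x\in G\}$; its elements are called metric-functionals. For left-invariant $d$, the group $G$ acts on $L(G,d)$ by $(x.h)(y)=h(x^{-1}y)-h(x^{-1})$, and this action preserves $\partial(G,d)$. The orbit of $h$ is $G.h=\{x.h : x\in G\}$. Banach metric: let $G$ be a finitely generated infinite group (Banach metrics are only defined on infinite groups). A metric $d$ on $G$ is a Banach metric if: (1) $d(x,y)$ is a non-negative integer for all $x,y\in G$; (2) $d(zx,zy)=d(x,y)$ for all $x,y,z\in G$; (3) for every $r>0$ the ball $\{x\in G : d(x,1)\le r\}$ is finite; (4) $(G,d)$ is quasi-isometric to a Cayley graph of $G$ (i.e. to $(G,d_S)$ for some finite symmetric generating set $S$); (5) every $h\in\partial(G,d)$ is an unbounded function on $G$. *)

theory Defs
  imports "HOL-Algebra.Elementary_Groups" "HOL-Algebra.Group_Action" "HOL-Analysis.Analysis"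
begin

definition finitely_generated_group :: "('a, 'm) monoid_scheme \<Rightarrow> bool" where
  "finitely_generated_group G \<longleftrightarrow>
     group G \<and> (\<exists>S. finite S \<and> S \<subseteq> carrier G \<and> generate G S = carrier G)"

definition virtual_homomorphism :: "('a, 'm) monoid_scheme \<Rightarrow> ('a \<Rightarrow> int) \<Rightarrow> bool" where
  "virtual_homomorphism G \<phi> \<longleftrightarrow>
     (\<exists>H. subgroup H G \<and> finite (rcosets\<^bsub>G\<^esub> H) \<and>
          \<phi> \<in> hom (G\<lparr>carrier := H\<rparr>) integer_group \<and> (\<exists>x\<in>H. \<phi> x \<noteq> 0))"

definition finite_symmetric_generating_set :: "('a, 'm) monoid_scheme \<Rightarrow> 'a set \<Rightarrow> bool" where
  "finite_symmetric_generating_set G S \<longleftrightarrow>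
     finite S \<and> S \<subseteq> carrier G \<and> m_inv G ` S = S \<and> generate G S = carrier G"

definition cayley_edges :: "('a, 'm) monoid_scheme \<Rightarrow> 'a set \<Rightarrow> ('a \<times> 'a) set" where
  "cayley_edges G S =
     {(x, y). x \<in> carrier G \<and> y \<in> carrier G \<and> inv\<^bsub>G\<^esub> x \<otimes>\<^bsub>G\<^esub> y \<in> S}"

text \<open>
  The graph metric of the Cayley graph: the least length of an edge path from \<open>x\<close> to \<open>y\<close>.
  Such a path exists for all elements of the group when \<open>S\<close> is a symmetric generating set;
  otherwise the value of \<open>LEAST\<close> may be unspecified.
\<close>
definition cayley_metric :: "('a, 'm) monoid_scheme \<Rightarrow> 'a set \<Rightarrow> 'a \<Rightarrow> 'a \<Rightarrow> real" where
  "cayley_metric G S x y = real (LEAST n. (x, y) \<in> cayley_edges G S ^^ n)"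

definition quasi_isometric ::
    "'a set \<Rightarrow> ('a \<Rightarrow> 'a \<Rightarrow> real) \<Rightarrow> 'b set \<Rightarrow> ('b \<Rightarrow> 'b \<Rightarrow> real) \<Rightarrow> bool" where
  "quasi_isometric X d Y \<rho> \<longleftrightarrow>
     (\<exists>\<phi> C. \<phi> \<in> X \<rightarrow> Y \<and> C > 0 \<and>
        (\<forall>y\<in>Y. \<exists>x\<in>X. \<rho> (\<phi> x) y \<le> C) \<and>
        (\<forall>x\<in>X. \<forall>x'\<in>X. inverse C * d x x' - C \<le> \<rho> (\<phi> x) (\<phi> x') \<and>
                        \<rho> (\<phi> x) (\<phi> x') \<le> C * d x x' + C))"

text \<open>
  Real functions on \<open>G\<close> are represented by extensional functions on \<open>carrier G\<close>, so that equality
  of functions is equality on the group, and the topology of pointwise convergence is the one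
  induced by the product topology.
\<close>
definition mf_functions ::
    "('a, 'm) monoid_scheme \<Rightarrow> ('a \<Rightarrow> 'a \<Rightarrow> real) \<Rightarrow> ('a \<Rightarrow> real) set" where
  "mf_functions G d =
     {h \<in> extensional (carrier G). h \<one>\<^bsub>G\<^esub> = 0 \<and>
        (\<forall>x\<in>carrier G. \<forall>y\<in>carrier G. \<bar>h x - h y\<bar> \<le> d x y)}"

definition mf_topology ::
    "('a, 'm) monoid_scheme \<Rightarrow> ('a \<Rightarrow> 'a \<Rightarrow> real) \<Rightarrow> ('a \<Rightarrow> real) topology" where
  "mf_topology G d =
     subtopology (product_topology (\<lambda>_. euclideanreal) (carrier G)) (mf_functions G d)"

definition mf_embed ::
    "('a, 'm) monoid_scheme \<Rightarrow> ('a \<Rightarrow> 'a \<Rightarrow> real) \<Rightarrow> 'a \<Rightarrow> ('a \<Rightarrow> real)" where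
  "mf_embed G d x = (\<lambda>y\<in>carrier G. d x y - d x \<one>\<^bsub>G\<^esub>)"

definition mf_boundary ::
    "('a, 'm) monoid_scheme \<Rightarrow> ('a \<Rightarrow> 'a \<Rightarrow> real) \<Rightarrow> ('a \<Rightarrow> real) set" where
  "mf_boundary G d =
     (mf_topology G d closure_of (mf_embed G d ` carrier G)) - mf_embed G d ` carrier G"

definition mf_action ::
    "('a, 'm) monoid_scheme \<Rightarrow> 'a \<Rightarrow> ('a \<Rightarrow> real) \<Rightarrow> ('a \<Rightarrow> real)" where
  "mf_action G x h = (\<lambda>y\<in>carrier G. h (inv\<^bsub>G\<^esub> x \<otimes>\<^bsub>G\<^esub> y) - h (inv\<^bsub>G\<^esub> x))"

definition Banach_metric :: "('a, 'm) monoid_scheme \<Rightarrow> ('a \<Rightarrow> 'a \<Rightarrow> real) \<Rightarrow> bool" where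
  "Banach_metric G d \<longleftrightarrow>
     finitely_generated_group G \<and> infinite (carrier G) \<and> Metric_space (carrier G) d \<and>
     (\<forall>x\<in>carrier G. \<forall>y\<in>carrier G. d x y \<in> \<nat>) \<and>
     (\<forall>x\<in>carrier G. \<forall>y\<in>carrier G. \<forall>z\<in>carrier G. d (z \<otimes>\<^bsub>G\<^esub> x) (z \<otimes>\<^bsub>G\<^esub> y) = d x y) \<and>
     (\<forall>r>0. finite {x \<in> carrier G. d x \<one>\<^bsub>G\<^esub> \<le> r}) \<and>
     (\<exists>S. finite_symmetric_generating_set G S \<and>
          quasi_isometric (carrier G) d (carrier G) (cayley_metric G S)) \<and>
     (\<forall>h\<in>mf_boundary G d. \<not> bounded (h ` carrier G))"

end

theory Submission
  imports Defs
begin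

text \<open>
  A homomorphism on a subgroup \<open>H\<close> of finite index induces an integer cocycle \<open>c\<close> over the action of \<open>G\<close>
  on the finite set \<open>X\<close> of cosets, and \<open>p x = (\<Sum>C\<in>X. \<bar>c x C\<bar>)\<close> is a symmetric subadditive function.
  On the normal subgroup \<open>N\<close> acting trivially on \<open>X\<close> the coordinates of \<open>c\<close> are homomorphisms, and some
  \<open>t \<in> N\<close> has no vanishing coordinate. The metric is the maximum of a Cayley metric and a multiple \<open>M p\<close>,
  with \<open>M\<close> so large that \<open>M p\<close> dominates along the powers of \<open>t\<close>; there the absolute values in \<open>p\<close>
  are eventually resolved by the signs of \<open>c t C\<close>, so the limiting metric-functional is linear in \<open>c\<close>
  and is fixed by \<open>N\<close>. Metric-functionals of this metric are unbounded because from any \<open>x\<close> a bounded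
  change of position alters the distance substantially: one can either move along a Cayley geodesic or
  increase \<open>p\<close>. A homomorphism onto \<open>\<int>\<close> is the case of a one-point \<open>X\<close>, where \<open>N\<close> is all of \<open>G\<close>.

  Conversely, a metric-functional with finite orbit is a homomorphism on its stabiliser, integer valued
  as a limit of integer functions; were it zero there, it would take only finitely many values.
\<close>

lemma (in group) mult_inv_cancel:
  "x \<in> carrier G \<Longrightarrow> y \<in> carrier G \<Longrightarrow> x \<otimes> (inv x \<otimes> y) = y"
  by (simp flip: m_assoc)

lemma (in group) inv_mult_cancel:
  "x \<in> carrier G \<Longrightarrow> y \<in> carrier G \<Longrightarrow> inv x \<otimes> (x \<otimes> y) = y"
  by (simp flip: m_assoc)

section \<open>Word length\<close>

locale generated_group = group G for G :: "('a, 'm) monoid_scheme" (structure) +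
  fixes S :: "'a set"
  assumes fsgs: "finite_symmetric_generating_set G S"
begin

abbreviation "E \<equiv> cayley_edges G S"

definition wlen :: "'a \<Rightarrow> nat" where
  "wlen x = (LEAST n. (\<one>, x) \<in> E ^^ n)"

lemma finite_S: "finite S" and S_carrier: "S \<subseteq> carrier G"
  and inv_S: "s \<in> S \<Longrightarrow> inv s \<in> S" and generate_S: "generate G S = carrier G"
  using fsgs unfolding finite_symmetric_generating_set_def by auto

lemma edgeD: "(x, y) \<in> E \<Longrightarrow> x \<in> carrier G \<and> y \<in> carrier G \<and> inv x \<otimes> y \<in> S"
  by (simp add: cayley_edges_def)

lemma edge_mult_right: "x \<in> carrier G \<Longrightarrow> s \<in> S \<Longrightarrow> (x, x \<otimes> s) \<in> E"
  using S_carrier by (auto simp: cayley_edges_def m_assoc[symmetric])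

lemma edge_sym: "(x, y) \<in> E \<Longrightarrow> (y, x) \<in> E"
  using inv_S[of "inv x \<otimes> y"] by (auto simp: cayley_edges_def inv_mult_group)

lemma edge_translate:
  assumes "(x, y) \<in> E" "z \<in> carrier G"
  shows "(z \<otimes> x, z \<otimes> y) \<in> E"
proof -
  have "inv (z \<otimes> x) \<otimes> (z \<otimes> y) = inv x \<otimes> y"
    using edgeD[OF assms(1)] assms(2) by (simp add: inv_mult_group m_assoc inv_solve_left')
  then show ?thesis
    using edgeD[OF assms(1)] assms(2) by (simp add: cayley_edges_def)
qed

lemma path_sym: "(x, y) \<in> E ^^ n \<Longrightarrow> (y, x) \<in> E ^^ n"
proof (induction n arbitrary: y)
  case (Suc n)
  then obtain w where "(x, w) \<in> E ^^ n" "(w, y) \<in> E" by auto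
  then show ?case using Suc.IH edge_sym relpow_Suc_I2 by metis
qed auto

lemma path_translate: "(x, y) \<in> E ^^ n \<Longrightarrow> z \<in> carrier G \<Longrightarrow> (z \<otimes> x, z \<otimes> y) \<in> E ^^ n"
proof (induction n arbitrary: y)
  case (Suc n)
  then obtain w where "(x, w) \<in> E ^^ n" "(w, y) \<in> E" by auto
  then show ?case using Suc.IH Suc.prems edge_translate by (meson relpow_Suc_I)
qed auto

lemma path_append: "(x, y) \<in> E ^^ m \<Longrightarrow> (y, z) \<in> E ^^ n \<Longrightarrow> (x, z) \<in> E ^^ (m + n)"
  by (auto simp: relpow_add)

lemma path_carrier: "(x, y) \<in> E ^^ n \<Longrightarrow> x \<in> carrier G \<Longrightarrow> y \<in> carrier G"
  by (cases n) (auto dest: edgeD)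

lemma path_from_one_mult:
  assumes "(\<one>, x) \<in> E ^^ m" "(\<one>, y) \<in> E ^^ n" "x \<in> carrier G"
  shows "(\<one>, x \<otimes> y) \<in> E ^^ (m + n)"
  using path_append[OF assms(1)] path_translate[OF assms(2,3)] assms(3) by simp

lemma path_exists: "x \<in> carrier G \<Longrightarrow> \<exists>n. (\<one>, x) \<in> E ^^ n"
proof -
  assume "x \<in> carrier G"
  then have "x \<in> generate G S" by (simp add: generate_S)
  then show ?thesis
  proof (induction x rule: generate.induct)
    case one
    have "(\<one>, \<one>) \<in> E ^^ 0" by simp
    then show ?case by blast
  next
    case (incl s)
    then have "(\<one>, s) \<in> E ^^ 1"
      using edge_mult_right[of \<one> s] S_carrier by auto
    then show ?case by blast
  next
    case (inv s)
    then have "(\<one>, inv s) \<in> E ^^ 1"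
      using edge_mult_right[of \<one> "inv s"] S_carrier inv_S[of s] by auto
    then show ?case by blast
  next
    case (eng x y)
    then have "x \<in> carrier G" using generate_S by blast
    then show ?case using eng path_from_one_mult by blast
  qed
qed

lemma wlen_path: "x \<in> carrier G \<Longrightarrow> (\<one>, x) \<in> E ^^ wlen x"
  unfolding wlen_def using path_exists by (rule LeastI_ex)

lemma wlen_le: "(\<one>, x) \<in> E ^^ n \<Longrightarrow> wlen x \<le> n"
  unfolding wlen_def by (rule Least_le)

lemma wlen_one [simp]: "wlen \<one> = 0"
  using wlen_le[of \<one> 0] by simp

lemma wlen_eq_0: "x \<in> carrier G \<Longrightarrow> wlen x = 0 \<Longrightarrow> x = \<one>"
  using wlen_path[of x] by simp

lemma wlen_mult: "x \<in> carrier G \<Longrightarrow> y \<in> carrier G \<Longrightarrow> wlen (x \<otimes> y) \<le> wlen x + wlen y"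
  by (intro wlen_le path_from_one_mult wlen_path)

lemma wlen_inv [simp]: "x \<in> carrier G \<Longrightarrow> wlen (inv x) = wlen x"
proof -
  have "wlen (inv x) \<le> wlen x" if x: "x \<in> carrier G" for x
    using path_translate[OF path_sym[OF wlen_path[OF x]], of "inv x"] x
    by (intro wlen_le) simp
  from this[of x] this[of "inv x"] show "x \<in> carrier G \<Longrightarrow> wlen (inv x) = wlen x"
    by simp
qed

lemma wlen_pow: "x \<in> carrier G \<Longrightarrow> wlen (x [^] (n::nat)) \<le> n * wlen x"
  by (induction n) (auto intro: order_trans[OF wlen_mult])

lemma cayley_metric_eq:
  assumes "x \<in> carrier G" "y \<in> carrier G"
  shows "cayley_metric G S x y = real (wlen (inv x \<otimes> y))"
proof -
  have "(x, y) \<in> E ^^ n \<longleftrightarrow> (\<one>, inv x \<otimes> y) \<in> E ^^ n" for n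
    using path_translate[of x y n "inv x"] path_translate[of \<one> "inv x \<otimes> y" n x] assms
    by (auto simp: m_assoc[symmetric])
  then show ?thesis by (simp add: cayley_metric_def wlen_def)
qed

lemma finite_sphere: "finite {x. (\<one>, x) \<in> E ^^ n}"
proof (induction n)
  case (Suc n)
  have "{x. (\<one>, x) \<in> E ^^ Suc n} \<subseteq> (\<lambda>(w, s). w \<otimes> s) ` ({x. (\<one>, x) \<in> E ^^ n} \<times> S)"
  proof
    fix x assume "x \<in> {x. (\<one>, x) \<in> E ^^ Suc n}"
    then obtain w where w: "(\<one>, w) \<in> E ^^ n" "(w, x) \<in> E" by auto
    have "x = w \<otimes> (inv w \<otimes> x)" using edgeD[OF w(2)] by (simp add: m_assoc[symmetric])
    then show "x \<in> (\<lambda>(w, s). w \<otimes> s) ` ({x. (\<one>, x) \<in> E ^^ n} \<times> S)"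
      using w edgeD[OF w(2)] by (intro rev_image_eqI[of "(w, inv w \<otimes> x)"]) auto
  qed
  then show ?case using Suc finite_S by (meson finite_SigmaI finite_imageI finite_subset)
qed auto

lemma finite_wlen_ball: "finite {x \<in> carrier G. wlen x \<le> n}"
proof (rule finite_subset)
  show "{x \<in> carrier G. wlen x \<le> n} \<subseteq> (\<Union>k\<le>n. {x. (\<one>, x) \<in> E ^^ k})"
    using wlen_path by auto
qed (use finite_sphere in auto)

text \<open>A geodesic from the identity to \<open>x\<close> is cut after \<open>r\<close> steps;
  translating its second piece back to the identity bounds the rest.\<close>

lemma wlen_split:
  assumes "x \<in> carrier G" "r \<le> wlen x"
  obtains y where "y \<in> carrier G" "wlen y \<le> r" "wlen (inv y \<otimes> x) \<le> wlen x - r"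
proof -
  have "(\<one>, x) \<in> E ^^ (r + (wlen x - r))" using wlen_path assms by simp
  then obtain y where y: "(\<one>, y) \<in> E ^^ r" "(y, x) \<in> E ^^ (wlen x - r)"
    by (auto simp: relpow_add)
  have "y \<in> carrier G" using path_carrier[OF y(1)] by simp
  moreover from this have "wlen (inv y \<otimes> x) \<le> wlen x - r"
    using path_translate[OF y(2), of "inv y"] by (intro wlen_le) simp
  ultimately show ?thesis using that wlen_le[OF y(1)] by blast
qed

lemma subadditive_le_wlen:
  fixes p :: "'a \<Rightarrow> int"
  assumes p: "\<And>x y. x \<in> carrier G \<Longrightarrow> y \<in> carrier G \<Longrightarrow> p (x \<otimes> y) \<le> p x + p y" "p \<one> = 0"
  obtains K where "K \<ge> 0" "\<And>x. x \<in> carrier G \<Longrightarrow> p x \<le> K * int (wlen x)"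
proof -
  \<comment> \<open>The \<open>0\<close> keeps the maximum defined for empty \<open>S\<close> and
    \<open>K\<close> nonnegative. Each edge of a path from the identity then raises \<open>p\<close>
    by at most \<open>K\<close>.\<close>
  define K where "K = Max (insert 0 (p ` S))"
  have K: "0 \<le> K" "\<And>s. s \<in> S \<Longrightarrow> p s \<le> K"
    using finite_S by (auto simp: K_def)
  have path: "p x \<le> K * int n" if "(\<one>, x) \<in> E ^^ n" for n x
    using that
  proof (induction n arbitrary: x)
    case (Suc n)
    then obtain w where w: "(\<one>, w) \<in> E ^^ n" "(w, x) \<in> E" by auto
    note e = edgeD[OF w(2)]
    have "p x = p (w \<otimes> (inv w \<otimes> x))" using e by (simp add: m_assoc[symmetric])
    also have "\<dots> \<le> p w + p (inv w \<otimes> x)" using e by (intro p) auto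
    also have "\<dots> \<le> K * int n + K" using Suc.IH[OF w(1)] K(2) e by (intro add_mono) auto
    finally show ?case by (simp add: algebra_simps)
  qed (use p in auto)
  show ?thesis using that K(1) path wlen_path by blast
qed

end

lemma (in group) generated_group_exists:
  assumes "finitely_generated_group G"
  obtains S where "generated_group G S"
proof -
  obtain T where T: "finite T" "T \<subseteq> carrier G" "generate G T = carrier G"
    using assms by (auto simp: finitely_generated_group_def)
  define S where "S = T \<union> m_inv G ` T"
  have "S \<subseteq> carrier G" using T by (auto simp: S_def)
  moreover have "generate G S = carrier G"
    using generate_incl[OF \<open>S \<subseteq> carrier G\<close>] mono_generate[of T S] T(3) by (auto simp: S_def)
  moreover have "m_inv G ` S = S"
  proof -
    have "m_inv G ` m_inv G ` T = T" using T(2) by (force simp: image_iff subset_iff)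
    then show ?thesis by (auto simp: S_def image_Un)
  qed
  ultimately have "finite_symmetric_generating_set G S"
    using T(1) by (simp add: finite_symmetric_generating_set_def S_def)
  then show ?thesis
    using that by (simp add: generated_group_def generated_group_axioms_def is_group)
qed

section \<open>Metric-functionals\<close>

text \<open>Basic neighbourhoods for pointwise convergence restrict only finitely many coordinates.
  \<open>T F\<close> is such a neighbourhood of \<open>h\<close>, so it meets the embedded
  group.\<close>

lemma mf_closure_approx:
  assumes h: "h \<in> mf_topology G d closure_of (mf_embed G d ` carrier G)"
    and F: "finite F" "F \<subseteq> carrier G" and "e > 0"
  obtains x where "x \<in> carrier G" "\<And>y. y \<in> F \<Longrightarrow> \<bar>mf_embed G d x y - h y\<bar> < e"
proof -
  define T where "T F = {g \<in> topspace (mf_topology G d). \<forall>y\<in>F. g y \<in> ball (h y) e}" for F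
  have "openin (mf_topology G d) (T F)"
    using F
  proof (induction F)
    case (insert y F)
    have "continuous_map (mf_topology G d) euclideanreal (\<lambda>g. g y)"
      unfolding mf_topology_def using insert.prems
      by (intro continuous_map_from_subtopology continuous_map_product_projection) auto
    then have "openin (mf_topology G d) {g \<in> topspace (mf_topology G d). g y \<in> ball (h y) e}"
      by (rule openin_continuous_map_preimage) simp
    moreover have "T (insert y F) =
        {g \<in> topspace (mf_topology G d). g y \<in> ball (h y) e} \<inter> T F"
      by (auto simp: T_def)
    ultimately show ?case using insert by auto
  qed (simp add: T_def)
  moreover have "h \<in> T F"
    using h \<open>e > 0\<close> by (auto simp: T_def in_closure_of)
  ultimately obtain x where "x \<in> carrier G" "mf_embed G d x \<in> T F"
    using h by (auto simp: in_closure_of)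
  then show ?thesis
    using that by (auto simp: T_def dist_real_def abs_minus_commute)
qed

lemma mf_closure_functions:
  "h \<in> mf_topology G d closure_of A \<Longrightarrow> h \<in> mf_functions G d"
  by (auto simp: mf_topology_def in_closure_of)

text \<open>Convergence in a product topology is coordinatewise, so a pointwise limit of embedded
  points is a topological limit and every neighbourhood of it contains one of them.\<close>

lemma mf_closure_limit:
  assumes sub: "mf_embed G d ` carrier G \<subseteq> mf_functions G d"
    and x: "\<And>n. x n \<in> carrier G" and h: "h \<in> mf_functions G d"
    and lim: "\<And>y. y \<in> carrier G \<Longrightarrow> (\<lambda>n. mf_embed G d (x n) y) \<longlonglongrightarrow> h y"
  shows "h \<in> mf_topology G d closure_of (mf_embed G d ` carrier G)"
proof -
  have "limitin (product_topology (\<lambda>_. euclideanreal) (carrier G)) (\<lambda>n. mf_embed G d (x n)) h sequentially"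
    using h lim by (auto simp: limitin_componentwise mf_functions_def mf_embed_def)
  then have lim: "limitin (mf_topology G d) (\<lambda>n. mf_embed G d (x n)) h sequentially"
    unfolding mf_topology_def using h x sub
    by (auto simp: limitin_subtopology image_subset_iff)
  show ?thesis
    unfolding in_closure_of
  proof (intro conjI allI impI)
    show "h \<in> topspace (mf_topology G d)" using lim by (rule limitin_topspace)
    fix T assume "h \<in> T \<and> openin (mf_topology G d) T"
    then have "\<forall>\<^sub>F n in sequentially. mf_embed G d (x n) \<in> T"
      using lim by (auto simp: limitin_def)
    then obtain n where "mf_embed G d (x n) \<in> T"
      using eventually_happens'[OF sequentially_bot] by blast
    then show "\<exists>y. y \<in> mf_embed G d ` carrier G \<and> y \<in> T" using x by blast
  qed
qed

lemma (in group) mf_embed_functions: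
  assumes "Metric_space (carrier G) d" "x \<in> carrier G"
  shows "mf_embed G d x \<in> mf_functions G d"
proof -
  interpret Metric_space "carrier G" d by fact
  have "\<bar>d x y - d x z\<bar> \<le> d y z" if "y \<in> carrier G" "z \<in> carrier G" for y z
    using triangle[of x y z] triangle[of x z y] assms(2) that commute[of y z] by linarith
  then show ?thesis by (auto simp: mf_functions_def mf_embed_def)
qed

text \<open>\<open>F\<close> serves all \<open>x\<close> at once, so it can be fixed before
  \<open>h\<close> is approximated: some embedded point is within 1 of \<open>h\<close> on
  \<open>F\<close>, which forces a value of \<open>h\<close> of absolute value above
  \<open>r - 1\<close>.\<close>

lemma (in group) mf_closure_unbounded:
  assumes h: "h \<in> mf_topology G d closure_of (mf_embed G d ` carrier G)"
    and F: "\<And>r::nat. \<exists>F. finite F \<and> F \<subseteq> carrier G \<and>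
              (\<forall>x\<in>carrier G. \<exists>y\<in>F. real r \<le> \<bar>d x y - d x \<one>\<bar>)"
  shows "\<not> bounded (h ` carrier G)"
proof
  assume "bounded (h ` carrier G)"
  then obtain B where B: "\<And>y. y \<in> carrier G \<Longrightarrow> \<bar>h y\<bar> \<le> B"
    by (auto simp: bounded_iff)
  obtain r :: nat where r: "B + 1 \<le> real r" using real_arch_simple by blast
  obtain F where F: "finite F" "F \<subseteq> carrier G"
    "\<And>x. x \<in> carrier G \<Longrightarrow> \<exists>y\<in>F. real r \<le> \<bar>d x y - d x \<one>\<bar>"
    using F[of r] by blast
  obtain x where x: "x \<in> carrier G" "\<And>y. y \<in> F \<Longrightarrow> \<bar>mf_embed G d x y - h y\<bar> < 1"
    using mf_closure_approx[OF h F(1,2), of 1] by auto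
  obtain y where "y \<in> F" "real r \<le> \<bar>d x y - d x \<one>\<bar>" using F(3)[OF x(1)] by blast
  moreover have "mf_embed G d x y = d x y - d x \<one>"
    using \<open>y \<in> F\<close> F(2) by (auto simp: mf_embed_def)
  moreover have "\<bar>h y\<bar> \<le> B" using B F(2) \<open>y \<in> F\<close> by blast
  ultimately show False using x(2)[of y] r by linarith
qed

section \<open>Cocycles over finite actions\<close>

text \<open>Without cancellation the absolute value is additive. Applied coordinatewise, this makes
  \<open>p\<close> grow linearly along suitable powers in \<open>p_expand\<close>.\<close>

lemma abs_add_same_sgn:
  fixes a b m :: int
  assumes "b = 0 \<or> sgn b = sgn a" "0 \<le> m"
  shows "\<bar>m * a + b\<bar> = m * \<bar>a\<bar> + \<bar>b\<bar>"
proof -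
  consider "a = 0" | "0 < a" | "a < 0" by linarith
  then show ?thesis
  proof cases
    case 2
    then have "0 \<le> b" "0 \<le> m * a" using assms by (auto simp: sgn_if split: if_splits)
    then show ?thesis using 2 by simp
  next
    case 3
    then have "b \<le> 0" "m * a \<le> 0"
      using assms by (auto simp: sgn_if mult_nonneg_nonpos split: if_splits)
    then show ?thesis using 3 by simp
  qed (use assms in auto)
qed


text \<open>\<open>act\<close> is a right action and \<open>c_mult\<close> the cocycle identity over
  it. The set \<open>X\<close> is kept abstract so that both the cosets of a subgroup and a single
  point are instances. The element in \<open>c_nontrivial\<close> may depend on \<open>C\<close>;
  \<open>generic_element_on\<close> later finds one for all of \<open>X\<close>.\<close>

locale finite_cocycle = generated_group G S
  for G :: "('a, 'm) monoid_scheme" (structure) and S +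
  fixes X :: "'x set" and act :: "'x \<Rightarrow> 'a \<Rightarrow> 'x" and c :: "'a \<Rightarrow> 'x \<Rightarrow> int"
  assumes finite_X: "finite X" and X_nonempty: "X \<noteq> {}"
    and act_closed [simp]: "C \<in> X \<Longrightarrow> x \<in> carrier G \<Longrightarrow> act C x \<in> X"
    and act_one [simp]: "C \<in> X \<Longrightarrow> act C \<one> = C"
    and act_mult: "C \<in> X \<Longrightarrow> x \<in> carrier G \<Longrightarrow> y \<in> carrier G \<Longrightarrow> act C (x \<otimes> y) = act (act C x) y"
    and c_mult: "C \<in> X \<Longrightarrow> x \<in> carrier G \<Longrightarrow> y \<in> carrier G \<Longrightarrow>
                   c (x \<otimes> y) C = c x C + c y (act C x)"
    and c_nontrivial: "C \<in> X \<Longrightarrow> \<exists>x\<in>carrier G. (\<forall>D\<in>X. act D x = D) \<and> c x C \<noteq> 0"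
begin

definition N :: "'a set" where "N = {x \<in> carrier G. \<forall>C\<in>X. act C x = C}"

definition p :: "'a \<Rightarrow> int" where "p x = (\<Sum>C\<in>X. \<bar>c x C\<bar>)"

lemma N_I: "x \<in> carrier G \<Longrightarrow> (\<And>C. C \<in> X \<Longrightarrow> act C x = C) \<Longrightarrow> x \<in> N"
  by (simp add: N_def)

lemma N_carrier: "x \<in> N \<Longrightarrow> x \<in> carrier G" and N_act [simp]: "x \<in> N \<Longrightarrow> C \<in> X \<Longrightarrow> act C x = C"
  by (auto simp: N_def)

lemma N_mult: "x \<in> N \<Longrightarrow> y \<in> N \<Longrightarrow> x \<otimes> y \<in> N"
  by (intro N_I) (auto simp: N_carrier act_mult)

lemma N_pow: "x \<in> N \<Longrightarrow> x [^] (n::nat) \<in> N"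
  by (induction n) (auto intro: N_I N_mult)

lemma act_inv: "C \<in> X \<Longrightarrow> x \<in> carrier G \<Longrightarrow> act (act C x) (inv x) = C"
  by (simp flip: act_mult)

lemma act_inv': "C \<in> X \<Longrightarrow> x \<in> carrier G \<Longrightarrow> act (act C (inv x)) x = C"
  by (simp flip: act_mult)

lemma N_if_act_eq:
  assumes "x \<in> carrier G" "y \<in> carrier G" "\<And>C. C \<in> X \<Longrightarrow> act C x = act C y"
  shows "x \<otimes> inv y \<in> N"
  using assms by (intro N_I) (auto simp: act_mult act_inv)

text \<open>Every group element permutes \<open>X\<close>. This removes the shift
  \<open>act C x\<close> that the cocycle identity introduces, in \<open>p_mult\<close>,
  \<open>p_inv\<close> and \<open>p_far\<close>.\<close>

lemma sum_act: "x \<in> carrier G \<Longrightarrow> (\<Sum>C\<in>X. f (act C x)) = (\<Sum>C\<in>X. f C)"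
  by (rule sum.reindex_bij_witness[of _ "\<lambda>C. act C (inv x)" "\<lambda>C. act C x"])
    (auto simp: act_inv act_inv')

lemma c_one [simp]: "C \<in> X \<Longrightarrow> c \<one> C = 0"
  using c_mult[of C \<one> \<one>] by simp

lemma c_inv: "C \<in> X \<Longrightarrow> x \<in> carrier G \<Longrightarrow> c (inv x) (act C x) = - c x C"
  using c_mult[of C x "inv x"] by simp

text \<open>The left factor fixes every point, so the twist in the cocycle identity disappears. The
  right factor is arbitrary, which is what makes \<open>h\<close> additive in
  \<open>h_N_mult\<close>.\<close>

lemma c_N_mult: "C \<in> X \<Longrightarrow> x \<in> N \<Longrightarrow> y \<in> carrier G \<Longrightarrow> c (x \<otimes> y) C = c x C + c y C"
  by (simp add: c_mult N_carrier)

lemma c_N_pow: "C \<in> X \<Longrightarrow> x \<in> N \<Longrightarrow> c (x [^] (n::nat)) C = int n * c x C"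
  by (induction n) (simp_all add: c_N_mult N_pow N_carrier algebra_simps)

lemma p_one [simp]: "p \<one> = 0" and p_nonneg [simp]: "0 \<le> p x"
  by (simp_all add: p_def sum_nonneg)

lemma c_le_p: "C \<in> X \<Longrightarrow> \<bar>c x C\<bar> \<le> p x"
  unfolding p_def by (intro member_le_sum) (auto simp: finite_X)

lemma p_mult:
  assumes "x \<in> carrier G" "y \<in> carrier G"
  shows "p (x \<otimes> y) \<le> p x + p y"
proof -
  have "p (x \<otimes> y) \<le> (\<Sum>C\<in>X. \<bar>c x C\<bar> + \<bar>c y (act C x)\<bar>)"
    unfolding p_def using assms by (intro sum_mono) (simp add: c_mult)
  then show ?thesis
    using sum_act[OF assms(1), of "\<lambda>C. \<bar>c y C\<bar>"] by (simp add: p_def sum.distrib)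
qed

lemma p_inv [simp]: "x \<in> carrier G \<Longrightarrow> p (inv x) = p x"
  unfolding p_def using sum_act[of x "\<lambda>C. \<bar>c (inv x) C\<bar>"] by (simp add: c_inv)

lemma p_N_pow: "x \<in> N \<Longrightarrow> p (x [^] (n::nat)) = int n * p x"
  by (simp add: p_def c_N_pow abs_mult sum_distrib_left)

section \<open>Finite index of \<open>N\<close>, elements without vanishing coordinates, and growth
  of \<open>p\<close>\<close>

lemma finite_act: "finite ((\<lambda>x. \<lambda>C\<in>X. act C x) ` carrier G)"
  by (rule finite_subset[OF _ finite_PiE[of X "\<lambda>_. X"]]) (auto simp: finite_X)

text \<open>\<open>X\<close> has finitely many self-maps, and two elements inducing the same one
  differ by a left factor in \<open>N\<close>; one representative per map suffices.\<close>

lemma N_transversal: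
  obtains R where "finite R" "R \<subseteq> carrier G" "\<And>x. x \<in> carrier G \<Longrightarrow> \<exists>g\<in>R. x \<otimes> inv g \<in> N"
proof -
  let ?\<pi> = "\<lambda>x. \<lambda>C\<in>X. act C x"
  obtain R where R: "R \<subseteq> carrier G" "finite R" "?\<pi> ` carrier G = ?\<pi> ` R"
    using finite_subset_image[OF finite_act subset_refl] by blast
  have "\<exists>g\<in>R. x \<otimes> inv g \<in> N" if x: "x \<in> carrier G" for x
  proof -
    obtain g where g: "g \<in> R" "?\<pi> x = ?\<pi> g" using R(3) x by blast
    then have "act C x = act C g" if "C \<in> X" for C using that by (metis restrict_apply')
    then show ?thesis using g R(1) x by (intro bexI[of _ g] N_if_act_eq) auto
  qed
  then show ?thesis using that R by blast
qed

text \<open>A product \<open>x\<^sup>m y\<close> with \<open>m\<close> large keeps the non-vanishing coordinates of \<open>x\<close> and adds that of \<open>y\<close>.\<close>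
lemma generic_element_on: "finite Y \<Longrightarrow> Y \<subseteq> X \<Longrightarrow> \<exists>x\<in>N. \<forall>C\<in>Y. c x C \<noteq> 0"
proof (induction Y rule: finite_induct)
  case empty
  have "\<one> \<in> N" by (intro N_I) auto
  then show ?case by blast
next
  case (insert D Y)
  then obtain x where x: "x \<in> N" "\<And>C. C \<in> Y \<Longrightarrow> c x C \<noteq> 0" by auto
  obtain y where y: "y \<in> N" "c y D \<noteq> 0"
    using c_nontrivial[of D] insert.prems by (blast intro: N_I)
  show ?case
  proof (cases "c x D = 0")
    case True
    \<comment> \<open>\<open>m\<close> exceeds \<open>p y\<close> and hence every coordinate of
      \<open>y\<close>, so the nonzero coordinates of \<open>x\<close> survive; at \<open>D\<close>
      only the contribution of \<open>y\<close> remains.\<close>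
    define m where "m = Suc (nat (p y))"
    have "c (x [^] m \<otimes> y) C \<noteq> 0" if C: "C \<in> insert D Y" for C
    proof -
      have CX: "C \<in> X" using C insert.prems by auto
      have eq: "c (x [^] m \<otimes> y) C = int m * c x C + c y C"
        using x y CX by (simp add: c_N_mult N_pow N_carrier c_N_pow)
      show ?thesis
      proof (cases "C = D")
        case False
        then have "int m * 1 \<le> int m * \<bar>c x C\<bar>" using x(2)[of C] C by (intro mult_left_mono) auto
        moreover have "\<bar>c y C\<bar> < int m" using c_le_p[OF CX, of y] by (simp add: m_def)
        ultimately have "\<bar>c y C\<bar> < \<bar>int m * c x C\<bar>" by (simp add: abs_mult)
        then show ?thesis using eq by linarith
      qed (use eq True y in simp)
    qed
    then show ?thesis using x y N_mult N_pow by blast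
  next
    case False
    then show ?thesis using x by blast
  qed
qed

definition t :: 'a where "t = (SOME x. x \<in> N \<and> (\<forall>C\<in>X. c x C \<noteq> 0))"

lemma t_N: "t \<in> N" and c_t: "C \<in> X \<Longrightarrow> c t C \<noteq> 0"
  using someI_ex[of "\<lambda>x. x \<in> N \<and> (\<forall>C\<in>X. c x C \<noteq> 0)"] generic_element_on[OF finite_X]
  unfolding t_def by auto

lemma t_carrier [simp]: "t \<in> carrier G"
  using t_N by (rule N_carrier)

lemma p_t: "1 \<le> p t"
proof -
  obtain C where "C \<in> X" using X_nonempty by blast
  then show ?thesis using c_le_p[of C t] c_t[of C] by linarith
qed

text \<open>Elements of \<open>N\<close> with equal sign patterns add up in norm, and there are finitely many patterns.\<close>
lemma p_expand:
  fixes k :: int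
  obtains F where "finite F" "F \<subseteq> carrier G" "\<And>x. x \<in> carrier G \<Longrightarrow> \<exists>z\<in>F. p x + k \<le> p (z \<otimes> x)"
proof -
  obtain R where R: "finite R" "R \<subseteq> carrier G" "\<And>x. x \<in> carrier G \<Longrightarrow> \<exists>g\<in>R. x \<otimes> inv g \<in> N"
    by (rule N_transversal) blast
  define \<sigma> where "\<sigma> n = (\<lambda>C\<in>X. sgn (c n C))" for n
  \<comment> \<open>Elements of norm zero are left out, so that each pattern is represented by some
    \<open>z\<close> with \<open>p z\<close> at least 1, whose powers grow.\<close>
  define N' where "N' = {n \<in> N. 0 < p n}"
  have "\<sigma> ` N' \<subseteq> (\<Pi>\<^sub>E C\<in>X. {-1, 0, 1})" by (auto simp: \<sigma>_def sgn_if split: if_splits)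
  then have "finite (\<sigma> ` N')" by (rule finite_subset) (auto intro: finite_PiE finite_X)
  then obtain P where P: "P \<subseteq> N'" "finite P" "\<sigma> ` N' = \<sigma> ` P"
    using finite_subset_image[of "\<sigma> ` N'" \<sigma> N'] by auto
  define B where "B = (\<Sum>g\<in>R. p g)"
  have B: "p g \<le> B" if "g \<in> R" for g
    unfolding B_def using that R(1) by (intro member_le_sum) auto
  \<comment> \<open>One \<open>B\<close> pays for replacing \<open>x\<close> by its part
    \<open>n\<close> in \<open>N\<close>, the other for returning from \<open>n\<close> to
    \<open>x\<close>.\<close>
  define q where "q = nat (k + 2 * B)"
  have "\<exists>z\<in>(\<lambda>z. z [^] q) ` insert t P. p x + k \<le> p (z \<otimes> x)" if x: "x \<in> carrier G" for x
  proof -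
    obtain g where g: "g \<in> R" "x \<otimes> inv g \<in> N" using R(3)[OF x] by blast
    have gc: "g \<in> carrier G" using g R(2) by auto
    define n where "n = x \<otimes> inv g"
    have n: "n \<in> N" using g by (simp add: n_def)
    \<comment> \<open>If all coordinates of \<open>n\<close> vanish, nothing can cancel and
      \<open>t\<close> serves.\<close>
    obtain z where z: "z \<in> insert t P" and sg: "\<And>C. C \<in> X \<Longrightarrow> c n C = 0 \<or> sgn (c n C) = sgn (c z C)"
    proof (cases "n \<in> N'")
      case True
      then obtain z where "z \<in> P" "\<sigma> n = \<sigma> z" using P(3) by blast
      then show ?thesis using that[of z] by (metis \<sigma>_def insertCI restrict_apply')
    next
      case False
      then have "p n = 0" using n p_nonneg[of n] by (simp add: N'_def)
      then have "c n C = 0" if "C \<in> X" for C using c_le_p[OF that, of n] by simp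
      then show ?thesis using that[of t] by simp
    qed
    have zN: "z \<in> N" "1 \<le> p z" using z P(1) t_N p_t by (auto simp: N'_def)
    have zc: "z [^] q \<in> carrier G" using zN N_carrier by simp
    have "p (z [^] q \<otimes> n) = (\<Sum>C\<in>X. int q * \<bar>c z C\<bar> + \<bar>c n C\<bar>)"
      unfolding p_def
    proof (rule sum.cong)
      fix C assume C: "C \<in> X"
      have "\<bar>int q * c z C + c n C\<bar> = int q * \<bar>c z C\<bar> + \<bar>c n C\<bar>"
        using sg[OF C] by (intro abs_add_same_sgn) auto
      then show "\<bar>c (z [^] q \<otimes> n) C\<bar> = int q * \<bar>c z C\<bar> + \<bar>c n C\<bar>"
        using C zN n by (simp add: c_N_mult N_pow N_carrier c_N_pow)
    qed simp
    also have "\<dots> = int q * p z + p n" by (simp add: p_def sum.distrib sum_distrib_left)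
    finally have 1: "p (z [^] q \<otimes> n) = int q * p z + p n" .
    have "int q * 1 \<le> int q * p z" using zN by (intro mult_left_mono) auto
    moreover have "k + 2 * B \<le> int q" by (simp add: q_def)
    moreover have "p (z [^] q \<otimes> n) \<le> p (z [^] q \<otimes> x) + p g"
      using p_mult[of "z [^] q \<otimes> x" "inv g"] zc x gc by (simp add: n_def m_assoc)
    moreover have "p x \<le> p n + p g"
      using p_mult[of n g] x gc by (simp add: n_def m_assoc)
    ultimately have "p x + k \<le> p (z [^] q \<otimes> x)" using 1 B[OF g(1)] by linarith
    then show ?thesis using z by blast
  qed
  moreover have "(\<lambda>z. z [^] q) ` insert t P \<subseteq> carrier G"
    using P(1) N_carrier by (auto simp: N'_def)
  ultimately show ?thesis using that[of "(\<lambda>z. z [^] q) ` insert t P"] P(2) by blast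
qed

section \<open>The metric of a cocycle\<close>

text \<open>Since \<open>p t\<close> is at least 1, \<open>M * p\<close> exceeds the bound
  \<open>n * wlen t\<close> on the word length of the \<open>n\<close>-th power of \<open>t\<close>
  by at least \<open>n\<close>, a surplus that absorbs any fixed \<open>y\<close> in
  \<open>L_far\<close>.\<close>

definition M :: int where "M = int (wlen t) + 1"

text \<open>Word length provides definiteness and finite balls. With a maximum in place of a sum, it
  leaves no trace where \<open>M * p\<close> dominates.\<close>

definition L :: "'a \<Rightarrow> int" where "L x = max (M * p x) (int (wlen x))"

text \<open>The default 0 makes symmetry hold for all arguments, because \<open>Metric_space\<close>
  states it without membership in the carrier.\<close>

definition d :: "'a \<Rightarrow> 'a \<Rightarrow> real" where
  "d x y = (if x \<in> carrier G \<and> y \<in> carrier G then of_int (L (inv x \<otimes> y)) else 0)"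

text \<open>The limit of the embedded powers of \<open>t\<close>: for large \<open>n\<close>, the
  absolute value of \<open>n * c t C - c y C\<close> is that of \<open>n * c t C\<close> minus
  \<open>sgn (c t C) * c y C\<close>.\<close>

definition h :: "'a \<Rightarrow> real" where
  "h = (\<lambda>y\<in>carrier G. of_int (- M * (\<Sum>C\<in>X. sgn (c t C) * c y C)))"

lemma h_extensional: "h \<in> extensional (carrier G)"
  by (simp add: h_def)

lemma M_ge_1: "1 \<le> M"
  by (simp add: M_def)

lemma L_nonneg [simp]: "0 \<le> L x" and wlen_le_L: "int (wlen x) \<le> L x" and p_le_L: "M * p x \<le> L x"
  by (auto simp: L_def)

lemma L_one [simp]: "L \<one> = 0"
  by (simp add: L_def)

lemma L_eq_0: "x \<in> carrier G \<Longrightarrow> L x = 0 \<Longrightarrow> x = \<one>"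
  using wlen_le_L[of x] by (intro wlen_eq_0) auto

lemma L_inv [simp]: "x \<in> carrier G \<Longrightarrow> L (inv x) = L x"
  by (simp add: L_def)

lemma L_mult:
  assumes "x \<in> carrier G" "y \<in> carrier G"
  shows "L (x \<otimes> y) \<le> L x + L y"
proof -
  have "M * p (x \<otimes> y) \<le> M * p x + M * p y"
    using mult_left_mono[OF p_mult[OF assms], of M] M_ge_1 by (simp add: algebra_simps)
  moreover have "int (wlen (x \<otimes> y)) \<le> int (wlen x) + int (wlen y)"
    using wlen_mult[OF assms] by simp
  ultimately show ?thesis unfolding L_def by linarith
qed

section \<open>The Banach metric axioms for \<open>d\<close>\<close>

lemma d_eq: "x \<in> carrier G \<Longrightarrow> y \<in> carrier G \<Longrightarrow> d x y = of_int (L (inv x \<otimes> y))"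
  by (simp add: d_def)

lemma d_commute: "d x y = d y x"
proof (cases "x \<in> carrier G \<and> y \<in> carrier G")
  case True
  then have "inv x \<otimes> y = inv (inv y \<otimes> x)" by (simp add: inv_mult_group)
  then show ?thesis using True by (simp add: d_eq)
qed (auto simp: d_def)

lemma Metric_space_d: "Metric_space (carrier G) d"
proof
  show "0 \<le> d x y" for x y by (simp add: d_def)
  show "d x y = d y x" for x y by (rule d_commute)
  show "d x y = 0 \<longleftrightarrow> x = y" if "x \<in> carrier G" "y \<in> carrier G" for x y
    using that L_eq_0[of "inv x \<otimes> y"] by (auto simp: d_eq inv_solve_left')
  show "d x z \<le> d x y + d y z" if "x \<in> carrier G" "y \<in> carrier G" "z \<in> carrier G" for x y z
  proof -
    have "inv x \<otimes> z = (inv x \<otimes> y) \<otimes> (inv y \<otimes> z)"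
      using that by (simp add: m_assoc mult_inv_cancel)
    then have "L (inv x \<otimes> z) \<le> L (inv x \<otimes> y) + L (inv y \<otimes> z)"
      using L_mult[of "inv x \<otimes> y" "inv y \<otimes> z"] that by simp
    then show ?thesis using that by (simp add: d_eq)
  qed
qed

lemma d_left_invariant:
  assumes "x \<in> carrier G" "y \<in> carrier G" "z \<in> carrier G"
  shows "d (z \<otimes> x) (z \<otimes> y) = d x y"
proof -
  have "inv (z \<otimes> x) \<otimes> (z \<otimes> y) = inv x \<otimes> y"
    using assms by (simp add: inv_mult_group m_assoc inv_solve_left')
  then show ?thesis using assms by (simp add: d_eq)
qed

lemma d_one: "x \<in> carrier G \<Longrightarrow> d x \<one> = of_int (L x)"
  by (simp add: d_eq)

lemma d_ball_finite: "finite {x \<in> carrier G. d x \<one> \<le> r}"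
proof (rule finite_subset)
  show "{x \<in> carrier G. d x \<one> \<le> r} \<subseteq> {x \<in> carrier G. wlen x \<le> nat \<lfloor>r\<rfloor>}"
  proof clarify
    fix x assume x: "x \<in> carrier G" "d x \<one> \<le> r"
    then have "L x \<le> \<lfloor>r\<rfloor>" by (simp add: d_one le_floor_iff)
    then show "wlen x \<le> nat \<lfloor>r\<rfloor>" using wlen_le_L[of x] by linarith
  qed
qed (rule finite_wlen_ball)

text \<open>\<open>p\<close> grows strictly along the powers of \<open>t\<close>, so
  \<open>t\<close> has infinite order.\<close>

lemma infinite_carrier: "infinite (carrier G)"
proof
  assume "finite (carrier G)"
  then have "finite (range (\<lambda>n::nat. t [^] n))" by (rule finite_subset[rotated]) auto
  moreover have "inj (\<lambda>n::nat. t [^] n)"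
  proof (rule injI)
    fix m n :: nat assume "t [^] m = t [^] n"
    then have "int m * p t = int n * p t" by (metis p_N_pow t_N)
    then show "m = n" using p_t by simp
  qed
  ultimately show False using finite_imageD infinite_UNIV_nat by blast
qed

lemma p_le_wlen:
  obtains K where "K \<ge> 0" "\<And>x. x \<in> carrier G \<Longrightarrow> p x \<le> K * int (wlen x)"
  by (rule subadditive_le_wlen[of p]) (auto intro: p_mult)

text \<open>The identity map is even bi-Lipschitz: \<open>L\<close> lies between the word length and
  \<open>M * K + 1\<close> times it.\<close>

lemma d_quasi_isometric: "quasi_isometric (carrier G) d (carrier G) (cayley_metric G S)"
proof -
  obtain K where K: "K \<ge> 0" "\<And>x. x \<in> carrier G \<Longrightarrow> p x \<le> K * int (wlen x)"
    by (rule p_le_wlen) blast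
  define A where "A = M * K + 1"
  have A: "1 \<le> A" using K M_ge_1 by (simp add: A_def)
  have L: "L x \<le> A * int (wlen x)" if "x \<in> carrier G" for x
  proof -
    have "M * p x \<le> M * (K * int (wlen x))"
      using K(2)[OF that] M_ge_1 by (intro mult_left_mono) auto
    moreover have "0 \<le> M * K * int (wlen x)" using K M_ge_1 by simp
    ultimately show ?thesis by (simp add: L_def A_def algebra_simps)
  qed
  define C :: real where "C = of_int A"
  have C: "1 \<le> C" using A by (simp add: C_def)
  show ?thesis
    unfolding quasi_isometric_def
  proof (intro exI[of _ id] exI[of _ C] conjI ballI)
    show "\<exists>x\<in>carrier G. cayley_metric G S (id x) y \<le> C" if "y \<in> carrier G" for y
      using that C by (intro bexI[of _ y]) (auto simp: cayley_metric_eq)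
  next
    fix x y assume xy: "x \<in> carrier G" "y \<in> carrier G"
    let ?w = "inv x \<otimes> y"
    have "of_int (L ?w) \<le> (of_int (A * int (wlen ?w)) :: real)"
      using L[of ?w] xy by (simp only: of_int_le_iff) simp
    then have 1: "d x y \<le> C * real (wlen ?w)" using xy by (simp add: d_eq C_def)
    then have "inverse C * d x y \<le> real (wlen ?w)"
      using C by (simp add: field_simps)
    then show "inverse C * d x y - C \<le> cayley_metric G S (id x) (id y)"
      using xy C by (simp add: cayley_metric_eq)
    have "(of_int (int (wlen ?w)) :: real) \<le> of_int (L ?w)" by (simp only: of_int_le_iff wlen_le_L)
    then have "real (wlen ?w) \<le> 1 * d x y" using xy by (simp add: d_eq)
    also have "\<dots> \<le> C * d x y" using C xy by (intro mult_right_mono) (auto simp: d_eq)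
    finally show "cayley_metric G S (id x) (id y) \<le> C * d x y + C"
      using xy C by (simp add: cayley_metric_eq)
  qed (use C in auto)
qed

text \<open>
  If the seminorm nearly dominates at \<open>x\<close>, the length is increased by expanding \<open>p\<close>; otherwise it is
  decreased along a geodesic of the Cayley graph.
\<close>
lemma L_varies:
  fixes r :: nat
  obtains F where "finite F" "F \<subseteq> carrier G"
    "\<And>x. x \<in> carrier G \<Longrightarrow> \<exists>y\<in>F. int r \<le> \<bar>L (inv x \<otimes> y) - L x\<bar>"
proof -
  obtain K where K: "K \<ge> 0" "\<And>x. x \<in> carrier G \<Longrightarrow> p x \<le> K * int (wlen x)"
    by (rule p_le_wlen) blast
  \<comment> \<open>\<open>M * K * r\<close> bounds the growth of \<open>M * p\<close> under a move
    of word length \<open>r\<close>; the further \<open>r\<close> is the decrease aimed at.\<close>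
  define A where "A = (M * K + 1) * int r"
  have A: "0 \<le> A" "A = M * K * int r + int r" using K M_ge_1 by (auto simp: A_def algebra_simps)
  \<comment> \<open>The gain must exceed \<open>r\<close> by \<open>A\<close>, because
    \<open>L x\<close> may be larger than \<open>M * p x\<close> by up to \<open>A\<close> in the
    first case below.\<close>
  obtain F where F: "finite F" "F \<subseteq> carrier G"
    "\<And>x. x \<in> carrier G \<Longrightarrow> \<exists>z\<in>F. p x + (A + int r) \<le> p (z \<otimes> x)"
    by (rule p_expand[of "A + int r"]) blast
  \<comment> \<open>The inverses turn left multiplication by \<open>z\<close> into a change of
    position: \<open>inv x \<otimes> inv z\<close> is the inverse of \<open>z \<otimes> x\<close>,
    and \<open>L\<close> is symmetric.\<close>
  define F' where "F' = m_inv G ` F \<union> {y \<in> carrier G. wlen y \<le> r}"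
  have "\<exists>y\<in>F'. int r \<le> \<bar>L (inv x \<otimes> y) - L x\<bar>" if x: "x \<in> carrier G" for x
  proof (cases "int (wlen x) < M * p x + A")
    case True
    obtain z where z: "z \<in> F" "p x + (A + int r) \<le> p (z \<otimes> x)" using F(3)[OF x] by blast
    have zc: "z \<in> carrier G" using z F by auto
    have "M * (p x + (A + int r)) \<le> M * p (z \<otimes> x)"
      using z M_ge_1 by (intro mult_left_mono) auto
    moreover have "1 * (A + int r) \<le> M * (A + int r)"
      using A M_ge_1 by (intro mult_right_mono) auto
    ultimately have "M * p x + A + int r \<le> M * p (z \<otimes> x)" by (simp add: algebra_simps)
    also have "\<dots> \<le> L (z \<otimes> x)" by (rule p_le_L)
    also have "L (z \<otimes> x) = L (inv (z \<otimes> x))" using zc x by simp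
    also have "inv (z \<otimes> x) = inv x \<otimes> inv z" using zc x by (simp add: inv_mult_group)
    finally have "M * p x + A + int r \<le> L (inv x \<otimes> inv z)" .
    moreover have "L x \<le> M * p x + A" using True A by (simp add: L_def)
    ultimately have "int r \<le> \<bar>L (inv x \<otimes> inv z) - L x\<bar>" by linarith
    then show ?thesis using z by (auto simp: F'_def)
  next
    case False
    have "0 \<le> M * p x" "0 \<le> M * K * int r" using K M_ge_1 by auto
    then have "r \<le> wlen x" using False A by linarith
    then obtain y where y: "y \<in> carrier G" "wlen y \<le> r" "wlen (inv y \<otimes> x) \<le> wlen x - r"
      using wlen_split x by blast
    have "p y \<le> K * int r"
      using K(2)[OF y(1)] mult_left_mono[of "int (wlen y)" "int r" K] y(2) K(1) by linarith
    moreover have "p (inv y \<otimes> x) \<le> p y + p x" using p_mult[of "inv y" x] y x by simp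
    ultimately have "p (inv y \<otimes> x) \<le> K * int r + p x" by linarith
    then have "M * p (inv y \<otimes> x) \<le> M * (K * int r + p x)"
      using M_ge_1 by (intro mult_left_mono) auto
    also have "\<dots> \<le> int (wlen x) - int r" using False A by (simp add: algebra_simps)
    finally have "L (inv y \<otimes> x) \<le> int (wlen x) - int r"
      using y(3) \<open>r \<le> wlen x\<close> by (simp add: L_def)
    moreover have "L (inv y \<otimes> x) = L (inv x \<otimes> y)"
      using L_inv[of "inv x \<otimes> y"] x y by (simp add: inv_mult_group)
    ultimately have "int r \<le> \<bar>L (inv x \<otimes> y) - L x\<bar>" using wlen_le_L[of x] by linarith
    then show ?thesis using y by (auto simp: F'_def)
  qed
  moreover have "finite F'" "F' \<subseteq> carrier G" using F finite_wlen_ball by (auto simp: F'_def)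
  ultimately show ?thesis using that by blast
qed

lemma Banach_metric_d: "Banach_metric G d"
proof -
  have "\<not> bounded (f ` carrier G)" if f: "f \<in> mf_boundary G d" for f
  proof (rule mf_closure_unbounded[of f d])
    show "f \<in> mf_topology G d closure_of (mf_embed G d ` carrier G)"
      using f by (simp add: mf_boundary_def)
    fix r :: nat
    obtain F where F: "finite F" "F \<subseteq> carrier G"
      "\<And>x. x \<in> carrier G \<Longrightarrow> \<exists>y\<in>F. int r \<le> \<bar>L (inv x \<otimes> y) - L x\<bar>"
      by (rule L_varies) blast
    have "\<exists>y\<in>F. real r \<le> \<bar>d x y - d x \<one>\<bar>" if x: "x \<in> carrier G" for x
    proof -
      obtain y where y: "y \<in> F" "int r \<le> \<bar>L (inv x \<otimes> y) - L x\<bar>" using F(3)[OF x] by blast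
      have "d x y - d x \<one> = of_int (L (inv x \<otimes> y) - L x)"
        using x y F(2) by (simp add: d_one d_eq subset_iff)
      then have "\<bar>d x y - d x \<one>\<bar> = of_int \<bar>L (inv x \<otimes> y) - L x\<bar>" by simp
      moreover have "real r \<le> of_int \<bar>L (inv x \<otimes> y) - L x\<bar>"
        using y(2) by (metis of_int_le_iff of_int_of_nat_eq)
      ultimately show ?thesis using y(1) by (intro bexI[of _ y]) auto
    qed
    then show "\<exists>F. finite F \<and> F \<subseteq> carrier G \<and> (\<forall>x\<in>carrier G. \<exists>y\<in>F. real r \<le> \<bar>d x y - d x \<one>\<bar>)"
      using F by blast
  qed
  moreover have "d x y \<in> \<nat>" if "x \<in> carrier G" "y \<in> carrier G" for x y
    using that by (auto simp: d_eq Nats_altdef2)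
  moreover have "finitely_generated_group G"
    using finite_S S_carrier generate_S is_group by (auto simp: finitely_generated_group_def)
  ultimately show ?thesis
    using infinite_carrier Metric_space_d d_left_invariant d_ball_finite fsgs d_quasi_isometric
    unfolding Banach_metric_def by blast
qed

section \<open>The limiting metric-functional along the powers of \<open>t\<close>, and its
  orbit\<close>

text \<open>Read at the point \<open>act C y\<close>, the cocycle is
  \<open>n * c t C - c y C\<close>. As \<open>n\<close> dominates \<open>c y C\<close> and
  \<open>c t C\<close> is a nonzero integer, the sign of \<open>c t C\<close> resolves the absolute
  value.\<close>

lemma p_far:
  assumes y: "y \<in> carrier G" and n: "p y \<le> int n"
  shows "p (inv y \<otimes> t [^] n) = int n * p t - (\<Sum>C\<in>X. sgn (c t C) * c y C)"
proof -
  have "p (inv y \<otimes> t [^] n) = (\<Sum>C\<in>X. \<bar>c (inv y \<otimes> t [^] n) (act C y)\<bar>)"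
    unfolding p_def using y by (simp add: sum_act[where f = "\<lambda>C. \<bar>c (inv y \<otimes> t [^] n) C\<bar>"])
  also have "\<dots> = (\<Sum>C\<in>X. int n * \<bar>c t C\<bar> - sgn (c t C) * c y C)"
  proof (rule sum.cong)
    fix C assume C: "C \<in> X"
    have "\<bar>c y C\<bar> \<le> int n" using c_le_p[OF C, of y] n by linarith
    moreover have "int n * 1 \<le> int n * \<bar>c t C\<bar>" using c_t[OF C] by (intro mult_left_mono) auto
    ultimately have "\<bar>c y C\<bar> \<le> int n * \<bar>c t C\<bar>" by linarith
    moreover have "c (inv y \<otimes> t [^] n) (act C y) = int n * c t C - c y C"
      using C y t_N by (simp add: c_mult act_inv c_inv c_N_pow)
    ultimately show "\<bar>c (inv y \<otimes> t [^] n) (act C y)\<bar> = int n * \<bar>c t C\<bar> - sgn (c t C) * c y C"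
      using c_t[OF C] by (cases "c t C > 0") auto
  qed simp
  finally show ?thesis by (simp add: p_def sum_subtractf sum_distrib_left)
qed

lemma sgn_sum_le_p: "(\<Sum>C\<in>X. sgn (c t C) * c y C) \<le> p y"
  unfolding p_def by (intro sum_mono) (auto simp: sgn_if)

text \<open>Far along the powers of \<open>t\<close> the seminorm dominates, since \<open>M > wlen t\<close> and \<open>p t \<ge> 1\<close>.\<close>
lemma L_far:
  assumes y: "y \<in> carrier G" and n: "M * p y + int (wlen y) \<le> int n"
  shows "L (inv y \<otimes> t [^] n) = M * (int n * p t - (\<Sum>C\<in>X. sgn (c t C) * c y C))"
proof -
  let ?s = "\<Sum>C\<in>X. sgn (c t C) * c y C"
  have "1 * p y \<le> M * p y" using M_ge_1 by (intro mult_right_mono) auto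
  then have "p y \<le> int n" using n by linarith
  then have p: "p (inv y \<otimes> t [^] n) = int n * p t - ?s" by (rule p_far[OF y])
  have "wlen (inv y \<otimes> t [^] n) \<le> wlen y + n * wlen t"
    using wlen_mult[of "inv y" "t [^] n"] wlen_pow[of t n] y by simp
  then have "int (wlen (inv y \<otimes> t [^] n)) \<le> int (wlen y) + int n * int (wlen t)"
    by (metis of_nat_add of_nat_le_iff of_nat_mult)
  also have "\<dots> \<le> int n * M - M * p y" using n by (simp add: M_def algebra_simps)
  also have "\<dots> \<le> int n * M * p t - M * ?s"
  proof -
    have "int n * M * 1 \<le> int n * M * p t" using p_t M_ge_1 by (intro mult_left_mono) auto
    moreover have "M * ?s \<le> M * p y" using sgn_sum_le_p M_ge_1 by (intro mult_left_mono) auto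
    ultimately show ?thesis by linarith
  qed
  finally show ?thesis by (simp add: L_def p algebra_simps)
qed

lemma L_t_pow: "L (t [^] (n::nat)) = M * (int n * p t)"
  using L_far[of \<one> n] by simp

text \<open>The growing term \<open>M * (n * p t)\<close> cancels against the base point value, so
  the sequence is eventually constant at each \<open>y\<close>.\<close>

lemma mf_embed_t_pow:
  assumes y: "y \<in> carrier G" and n: "M * p y + int (wlen y) \<le> int n"
  shows "mf_embed G d (t [^] n) y = h y"
proof -
  have "mf_embed G d (t [^] n) y = d y (t [^] n) - d (t [^] n) \<one>"
    using y d_commute[of y] by (simp add: mf_embed_def)
  also have "\<dots> = of_int (L (inv y \<otimes> t [^] n) - L (t [^] n))" using y by (simp add: d_eq)
  also have "L (inv y \<otimes> t [^] n) - L (t [^] n) = - M * (\<Sum>C\<in>X. sgn (c t C) * c y C)"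
    unfolding L_far[OF assms] L_t_pow by (simp add: algebra_simps)
  finally show ?thesis using y by (simp add: h_def)
qed

lemma eventually_mf_embed_t_pow:
  "y \<in> carrier G \<Longrightarrow> \<forall>\<^sub>F n in sequentially. mf_embed G d (t [^] n) y = h y"
  using mf_embed_t_pow by (intro eventually_sequentiallyI[of "nat (M * p y + int (wlen y))"]) auto

text \<open>The Lipschitz bound involves two points only, and for large \<open>n\<close> an embedded
  power of \<open>t\<close> agrees with \<open>h\<close> at both.\<close>

lemma h_functions: "h \<in> mf_functions G d"
proof -
  have "\<bar>h x - h y\<bar> \<le> d x y" if "x \<in> carrier G" "y \<in> carrier G" for x y
  proof -
    have "\<forall>\<^sub>F n in sequentially. mf_embed G d (t [^] n) x = h x \<and> mf_embed G d (t [^] n) y = h y"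
      using that by (intro eventually_conj eventually_mf_embed_t_pow)
    then obtain n :: nat where "mf_embed G d (t [^] n) x = h x" "mf_embed G d (t [^] n) y = h y"
      using eventually_happens'[OF sequentially_bot] by blast
    then show ?thesis
      using mf_embed_functions[OF Metric_space_d, of "t [^] n"] that by (force simp: mf_functions_def)
  qed
  then show ?thesis by (auto simp: mf_functions_def h_def)
qed

text \<open>\<open>h\<close> is not embedded: it tends to minus infinity along the powers of
  \<open>t\<close>, whereas the functional of a group element \<open>x\<close> is bounded below by
  \<open>- L x\<close>.\<close>

lemma h_boundary: "h \<in> mf_boundary G d"
proof -
  have "h \<in> mf_topology G d closure_of (mf_embed G d ` carrier G)"
    using mf_embed_functions[OF Metric_space_d] h_functions eventually_mf_embed_t_pow
    by (intro mf_closure_limit[of _ _ "\<lambda>n. t [^] (n::nat)"]) (auto intro: tendsto_eventually)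
  moreover have "h \<noteq> mf_embed G d x" if x: "x \<in> carrier G" for x
  proof
    assume eq: "h = mf_embed G d x"
    define n where "n = Suc (nat (L x))"
    have "(\<Sum>C\<in>X. sgn (c t C) * c (t [^] n) C) = int n * p t"
      unfolding p_def sum_distrib_left using t_N by (intro sum.cong) (auto simp: c_N_pow abs_sgn)
    then have "h (t [^] n) = of_int (- M * (int n * p t))" by (simp add: h_def flip: of_int_mult of_int_sum)
    moreover have "- of_int (L x) \<le> mf_embed G d x (t [^] n)"
      using x by (simp add: mf_embed_def d_one d_eq)
    ultimately have "- L x \<le> - M * (int n * p t)"
      using eq by (metis of_int_le_iff of_int_minus)
    moreover have "int n * 1 \<le> int n * p t" using p_t by (intro mult_left_mono) auto
    moreover have "1 * (int n * p t) \<le> M * (int n * p t)"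
      using M_ge_1 by (intro mult_right_mono) auto
    moreover have "L x < int n" by (simp add: n_def)
    ultimately show False by simp
  qed
  ultimately show ?thesis by (auto simp: mf_boundary_def)
qed

lemma h_N_mult: "x \<in> N \<Longrightarrow> y \<in> carrier G \<Longrightarrow> h (x \<otimes> y) = h x + h y"
  by (simp add: h_def N_carrier c_N_mult sum.distrib algebra_simps)

lemma N_inv: "x \<in> N \<Longrightarrow> inv x \<in> N"
  by (metis N_I N_act N_carrier act_inv inv_closed)

lemma h_fixed: "x \<in> N \<Longrightarrow> mf_action G x h = h"
  using h_N_mult[OF N_inv] N_carrier
  by (intro extensionalityI[of _ "carrier G"]) (auto simp: mf_action_def h_extensional)

text \<open>Write \<open>inv x\<close> as \<open>n \<otimes> g\<close> with \<open>n\<close> in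
  \<open>N\<close> and \<open>g\<close> in the transversal. The additive constant \<open>h n\<close>
  cancels in the action, so \<open>x\<close> acts on \<open>h\<close> as \<open>inv g\<close>
  does.\<close>

lemma h_orbit: "finite (Group_Action.orbit G (mf_action G) h)"
proof -
  obtain R where R: "finite R" "R \<subseteq> carrier G" "\<And>x. x \<in> carrier G \<Longrightarrow> \<exists>g\<in>R. x \<otimes> inv g \<in> N"
    by (rule N_transversal) blast
  have "\<exists>g\<in>R. mf_action G x h = mf_action G (inv g) h" if x: "x \<in> carrier G" for x
  proof -
    obtain g where g: "g \<in> R" "inv x \<otimes> inv g \<in> N" using R(3)[of "inv x"] x by blast
    have gc: "g \<in> carrier G" using g R by auto
    have shift: "h (inv x \<otimes> y) = h (inv x \<otimes> inv g) + h (g \<otimes> y)" if "y \<in> carrier G" for y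
    proof -
      have "inv x \<otimes> y = (inv x \<otimes> inv g) \<otimes> (g \<otimes> y)"
        using x gc that by (simp add: m_assoc inv_mult_cancel)
      then show ?thesis using h_N_mult[OF g(2), of "g \<otimes> y"] gc that by simp
    qed
    have "mf_action G x h = mf_action G (inv g) h"
      unfolding mf_action_def
    proof (rule restrict_ext)
      fix y assume "y \<in> carrier G"
      then show "h (inv x \<otimes> y) - h (inv x) = h (inv (inv g) \<otimes> y) - h (inv (inv g))"
        using shift[of y] shift[of \<one>] x gc by simp
    qed
    then show ?thesis using g by blast
  qed
  then have "Group_Action.orbit G (mf_action G) h \<subseteq> (\<lambda>g. mf_action G (inv g) h) ` R"
    by (auto simp: Group_Action.orbit_def)
  then show ?thesis using R(1) by (meson finite_imageI finite_subset)
qed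

end

section \<open>The cocycle of a virtual homomorphism\<close>

lemma finite_image_factor:
  assumes "finite (g ` A)" "\<And>x y. x \<in> A \<Longrightarrow> y \<in> A \<Longrightarrow> g x = g y \<Longrightarrow> f x = f y"
  shows "finite (f ` A)"
proof -
  obtain B where B: "B \<subseteq> A" "finite B" "g ` A = g ` B"
    using finite_subset_image[OF assms(1) subset_refl] by blast
  have "f ` A \<subseteq> f ` B"
  proof clarify
    fix x assume x: "x \<in> A"
    then obtain y where "y \<in> B" "g x = g y" using B(3) by blast
    then show "f x \<in> f ` B" using assms(2)[of x y] x B(1) by blast
  qed
  then show ?thesis using B(2) by (meson finite_imageI finite_subset)
qed

lemma (in group) rcosets_eq_image: "rcosets H = (\<lambda>x. H #> x) ` carrier G"
  by (auto simp: RCOSETS_def)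

lemma (in group) rcoset_eq_iff:
  assumes "subgroup H G" "x \<in> carrier G" "y \<in> carrier G"
  shows "H #> x = H #> y \<longleftrightarrow> x \<otimes> inv y \<in> H"
  using subgroup.rcos_module[OF assms(1) is_group assms(3,2)]
    repr_independence[OF _ assms(3,1), of x] rcos_self[OF assms(2,1)] by metis

text \<open>With a representative for each coset, \<open>rep C \<otimes> x\<close> is an element of
  \<open>H\<close> times \<open>rep (C #> x)\<close>; the cocycle is \<open>\<phi>\<close> of that
  element. In a product the intermediate representatives telescope, which gives the cocycle
  identity.\<close>

lemma (in group) finite_cocycle_rcosets:
  assumes gen: "generated_group G S" and H: "subgroup H G" and fin: "finite (rcosets H)"
    and \<phi>: "\<phi> \<in> hom (G\<lparr>carrier := H\<rparr>) integer_group" and u: "u \<in> H" "\<phi> u \<noteq> 0"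
  defines "rep \<equiv> \<lambda>C. SOME g. g \<in> C"
  shows "finite_cocycle G S (rcosets H) (#>) (\<lambda>x C. \<phi> (rep C \<otimes> x \<otimes> inv (rep (C #> x))))"
proof -
  have HG: "H \<subseteq> carrier G" using H by (rule subgroup.subset)
  have uG: "u \<in> carrier G" using u HG by blast
  have \<phi>_mult: "\<phi> (x \<otimes> y) = \<phi> x + \<phi> y" if "x \<in> H" "y \<in> H" for x y
    using \<phi> that by (auto simp: hom_def)
  have \<phi>_one: "\<phi> \<one> = 0" using \<phi>_mult[of \<one> \<one>] subgroup.one_closed[OF H] by simp
  have pow_H: "u [^] n \<in> H" for n :: nat
    by (induction n) (auto intro: u subgroup.one_closed[OF H] subgroup.m_closed[OF H])
  have \<phi>_pow: "\<phi> (u [^] n) = int n * \<phi> u" for n :: nat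
    by (induction n) (auto simp: \<phi>_one \<phi>_mult pow_H u algebra_simps)
  have rep: "rep C \<in> carrier G" "C = H #> rep C" if C: "C \<in> rcosets H" for C
  proof -
    obtain g where g: "g \<in> carrier G" "C = H #> g" using C unfolding rcosets_eq_image by blast
    then have "rep C \<in> C" unfolding rep_def using rcos_self[OF g(1) H] by (auto intro: someI)
    then show "rep C \<in> carrier G" "C = H #> rep C"
      using g r_coset_subset_G[OF HG g(1)] repr_independence[of "rep C" H g] H by auto
  qed
  have CG: "C \<subseteq> carrier G" if "C \<in> rcosets H" for C
    using rep[OF that] r_coset_subset_G[OF HG] by metis
  have closed: "C #> x \<in> rcosets H" if "C \<in> rcosets H" "x \<in> carrier G" for C x
    using rep[OF that(1)] that(2) coset_mult_assoc[OF HG, of "rep C" x] rcosetsI[OF HG]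
    by (metis m_closed)
  have mult: "C #> (x \<otimes> y) = C #> x #> y" if "C \<in> rcosets H" "x \<in> carrier G" "y \<in> carrier G" for C x y
    using coset_mult_assoc[OF CG[OF that(1)] that(2,3)] by simp
  have in_H: "rep C \<otimes> x \<otimes> inv (rep (C #> x)) \<in> H" if C: "C \<in> rcosets H" and x: "x \<in> carrier G" for C x
  proof -
    have "H #> (rep C \<otimes> x) = C #> x"
      using coset_mult_assoc[OF HG, of "rep C" x] rep[OF C] x by simp
    also have "\<dots> = H #> rep (C #> x)" using rep closed[OF C x] by blast
    finally show ?thesis
      using rcoset_eq_iff[OF H, of "rep C \<otimes> x" "rep (C #> x)"] rep(1) closed C x by simp
  qed
  \<comment> \<open>\<open>f n\<close> records how the \<open>n\<close>-th power of \<open>u\<close>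
    moves the cosets. Only finitely many such maps exist, so two powers agree and their quotient, a
    positive power of \<open>u\<close>, acts trivially.\<close>
  define f where "f n = (\<lambda>C\<in>rcosets H. C #> u [^] n)" for n :: nat
  have "finite (range f)"
    by (rule finite_subset[OF _ finite_PiE[OF fin, of "\<lambda>_. rcosets H"]])
      (use fin closed uG in \<open>auto simp: f_def\<close>)
  then have "\<not> inj f" using finite_imageD infinite_UNIV_nat by blast
  then obtain m n where mn: "m < n" and eq: "f m = f n"
    unfolding inj_def by (metis linorder_neqE_nat)
  define k where "k = n - m"
  have triv: "C #> u [^] k = C" if C: "C \<in> rcosets H" for C
  proof -
    have cl: "C #> u [^] k \<in> rcosets H" using closed C uG by simp
    have "C #> u [^] k #> u [^] m = C #> u [^] n"
      using mult[OF C, of "u [^] k" "u [^] m"] uG mn by (simp add: nat_pow_mult k_def)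
    also have "\<dots> = C #> u [^] m" using fun_cong[OF eq, of C] C by (simp add: f_def)
    finally have "C #> u [^] k #> u [^] m #> inv (u [^] m) = C #> u [^] m #> inv (u [^] m)" by simp
    then show ?thesis
      using mult[OF C, of "u [^] m" "inv (u [^] m)"] mult[OF cl, of "u [^] m" "inv (u [^] m)"]
        CG[OF C] CG[OF cl] uG by simp
  qed
  show ?thesis
  proof (intro finite_cocycle.intro gen finite_cocycle_axioms.intro fin closed mult)
    show "rcosets H \<noteq> {}" using rcosetsI[OF HG one_closed] by blast
    show "C #> \<one> = C" if "C \<in> rcosets H" for C using CG[OF that] by simp
  next
    fix C x y assume C: "C \<in> rcosets H" and x: "x \<in> carrier G" and y: "y \<in> carrier G"
    let ?D = "C #> x"
    have D: "?D \<in> rcosets H" using closed C x by blast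
    have DE: "?D #> y \<in> rcosets H" using closed D y by blast
    have "rep C \<otimes> (x \<otimes> y) \<otimes> inv (rep (?D #> y)) =
        (rep C \<otimes> x \<otimes> inv (rep ?D)) \<otimes> (rep ?D \<otimes> y \<otimes> inv (rep (?D #> y)))"
      using rep(1)[OF C] rep(1)[OF D] rep(1)[OF DE] x y by (simp add: m_assoc inv_mult_cancel)
    then show "\<phi> (rep C \<otimes> (x \<otimes> y) \<otimes> inv (rep (C #> (x \<otimes> y)))) =
        \<phi> (rep C \<otimes> x \<otimes> inv (rep ?D)) + \<phi> (rep ?D \<otimes> y \<otimes> inv (rep (?D #> y)))"
      using \<phi>_mult[OF in_H[OF C x] in_H[OF D y]] mult[OF C x y] by simp
  next
    fix C assume C: "C \<in> rcosets H"
    define g where "g = rep C"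
    have g: "g \<in> carrier G" using rep C by (simp add: g_def)
    \<comment> \<open>Conjugating by \<open>rep C\<close> keeps the action trivial and makes the
      coordinate at \<open>C\<close> equal to \<open>\<phi>\<close> of the \<open>k\<close>-th power
      of \<open>u\<close>, which is \<open>k * \<phi> u\<close>.\<close>
    define x where "x = inv g \<otimes> u [^] k \<otimes> g"
    have x: "x \<in> carrier G" using g uG by (simp add: x_def)
    have act: "D #> x = D" if D: "D \<in> rcosets H" for D
    proof -
      have D': "D #> inv g \<in> rcosets H" using closed D g by simp
      have "D #> x = D #> inv g #> u [^] k #> g"
        using mult D D' g uG by (simp add: x_def)
      also have "\<dots> = D" using triv[OF D'] mult[OF D, of "inv g" g] CG[OF D] g by simp
      finally show ?thesis .
    qed
    have "g \<otimes> x \<otimes> inv g = u [^] k"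
      using g uG by (simp add: x_def m_assoc mult_inv_cancel)
    then have "\<phi> (rep C \<otimes> x \<otimes> inv (rep (C #> x))) = int k * \<phi> u"
      using act[OF C] \<phi>_pow by (simp flip: g_def)
    then have "\<phi> (rep C \<otimes> x \<otimes> inv (rep (C #> x))) \<noteq> 0" using u mn by (simp add: k_def)
    then show "\<exists>x\<in>carrier G. (\<forall>D\<in>rcosets H. D #> x = D) \<and>
        \<phi> (rep C \<otimes> x \<otimes> inv (rep (C #> x))) \<noteq> 0"
      using x act by blast
  qed
qed

section \<open>Stabilisers of metric-functionals\<close>

lemma (in group) mf_action_mult:
  "x \<in> carrier G \<Longrightarrow> y \<in> carrier G \<Longrightarrow> mf_action G (x \<otimes> y) h = mf_action G x (mf_action G y h)"
  by (auto simp: mf_action_def inv_mult_group m_assoc)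

lemma (in group) mf_action_one: "h \<in> mf_functions G d \<Longrightarrow> mf_action G \<one> h = h"
  by (intro extensionalityI[of _ "carrier G"]) (auto simp: mf_action_def mf_functions_def)

text \<open>Each value of \<open>h\<close> is approximated by integers, and the integers are closed
  in the reals.\<close>

lemma mf_closure_Ints:
  assumes h: "h \<in> mf_topology G d closure_of (mf_embed G d ` carrier G)"
    and "\<one>\<^bsub>G\<^esub> \<in> carrier G" and y: "y \<in> carrier G"
    and int: "\<And>x y. x \<in> carrier G \<Longrightarrow> y \<in> carrier G \<Longrightarrow> d x y \<in> \<int>"
  shows "h y \<in> \<int>"
proof -
  have "h y \<in> closure \<int>"
    unfolding closure_approachable
  proof (intro allI impI)
    fix e :: real assume "e > 0"
    then obtain x where x: "x \<in> carrier G" "\<bar>mf_embed G d x y - h y\<bar> < e"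
      using mf_closure_approx[OF h, of "{y}" e] y by auto
    moreover have "mf_embed G d x y \<in> \<int>" using x(1) y assms(2) int by (simp add: mf_embed_def)
    ultimately show "\<exists>z\<in>\<int>. dist z (h y) < e" by (auto simp: dist_real_def)
  qed
  then show ?thesis by (simp add: closed_Ints)
qed

text \<open>The floor only changes the type, since \<open>h\<close> is integer valued on the whole
  group. The finite index subgroup is the stabiliser of \<open>h\<close>.\<close>

lemma (in group) virtual_homomorphism_if_finite_orbit:
  assumes B: "Banach_metric G d" and h: "h \<in> mf_boundary G d"
    and fin: "finite (Group_Action.orbit G (mf_action G) h)"
  shows "virtual_homomorphism G (\<lambda>x. \<lfloor>h x\<rfloor>)"
proof -
  define H where "H = {x \<in> carrier G. mf_action G x h = h}"
  have cl: "h \<in> mf_topology G d closure_of (mf_embed G d ` carrier G)"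
    using h by (simp add: mf_boundary_def)
  have one: "mf_action G \<one> h = h" using mf_action_one mf_closure_functions[OF cl] by blast
  have inv_eq: "mf_action G (inv x) (mf_action G x h) = h" if "x \<in> carrier G" for x
    using mf_action_mult[of "inv x" x h] that one by simp
  have H: "subgroup H G"
  proof (rule subgroupI)
    show "H \<noteq> {}" using one by (auto simp: H_def)
    show "inv x \<in> H" if "x \<in> H" for x using that inv_eq[of x] by (auto simp: H_def)
  qed (auto simp: H_def mf_action_mult)
  have H_eq: "x \<otimes> inv y \<in> H" if "x \<in> carrier G" "y \<in> carrier G" "mf_action G (inv x) h = mf_action G (inv y) h"
    for x y
    using that mf_action_mult[of x "inv y" h] inv_eq[of "inv x"] by (simp add: H_def)
  \<comment> \<open>Right cosets of the stabiliser correspond to orbit points through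
    \<open>inv x\<close>; through \<open>x\<close> they would be left cosets.\<close>
  have rc: "finite (rcosets H)"
    unfolding rcosets_eq_image
  proof (rule finite_image_factor[of "\<lambda>x. mf_action G (inv x) h"])
    show "finite ((\<lambda>x. mf_action G (inv x) h) ` carrier G)"
      by (rule finite_subset[OF _ fin]) (auto simp: Group_Action.orbit_def)
  qed (use H_eq rcoset_eq_iff[OF H] in blast)
  \<comment> \<open>Invariance is used for \<open>inv x\<close>, because the action translates the
    argument by the inverse. With \<open>y\<close> arbitrary, vanishing on \<open>H\<close> makes
    \<open>h\<close> constant on right cosets below.\<close>
  have h_mult: "h (x \<otimes> y) = h x + h y" if "x \<in> H" "y \<in> carrier G" for x y
  proof -
    have "mf_action G (inv x) h y = h y"
      using subgroup.m_inv_closed[OF H that(1)] by (simp add: H_def)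
    then show ?thesis using that by (simp add: mf_action_def H_def)
  qed
  have int: "h x \<in> \<int>" if "x \<in> carrier G" for x
    using mf_closure_Ints[OF cl one_closed that] B Nats_subset_Ints
    unfolding Banach_metric_def by blast
  have HG: "x \<in> carrier G" if "x \<in> H" for x using that by (simp add: H_def)
  have floor: "of_int \<lfloor>h x\<rfloor> = h x" if "x \<in> carrier G" for x
    using int[OF that] by (rule of_int_floor)
  have hom: "(\<lambda>x. \<lfloor>h x\<rfloor>) \<in> hom (G\<lparr>carrier := H\<rparr>) integer_group"
  proof (rule homI)
    fix x y assume "x \<in> carrier (G\<lparr>carrier := H\<rparr>)" "y \<in> carrier (G\<lparr>carrier := H\<rparr>)"
    then show "\<lfloor>h (x \<otimes>\<^bsub>G\<lparr>carrier := H\<rparr>\<^esub> y)\<rfloor> = \<lfloor>h x\<rfloor> \<otimes>\<^bsub>integer_group\<^esub> \<lfloor>h y\<rfloor>"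
      using h_mult[of x y] HG int[of x] by (simp add: floor_add2)
  qed simp
  have "\<exists>x\<in>H. \<lfloor>h x\<rfloor> \<noteq> 0"
  proof (rule ccontr)
    assume "\<not> (\<exists>x\<in>H. \<lfloor>h x\<rfloor> \<noteq> 0)"
    then have h0: "h x = 0" if "x \<in> H" for x using floor[OF HG[OF that]] that by auto
    have "finite (h ` carrier G)"
    proof (rule finite_image_factor[of "\<lambda>x. H #> x"])
      show "finite ((#>) H ` carrier G)" using rc by (simp add: rcosets_eq_image)
      fix x y assume xy: "x \<in> carrier G" "y \<in> carrier G" "H #> x = H #> y"
      then have "x \<otimes> inv y \<in> H" using rcoset_eq_iff[OF H] by blast
      then show "h x = h y" using h_mult[of "x \<otimes> inv y" y] h0 xy by (simp add: m_assoc)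
    qed
    then show False using B h finite_imp_bounded unfolding Banach_metric_def by blast
  qed
  then show ?thesis unfolding virtual_homomorphism_def using H rc hom by blast
qed

theorem theorem2p7:
  fixes G :: "('a, 'm) monoid_scheme"
  assumes "finitely_generated_group G"
  shows "((\<exists>\<phi>. virtual_homomorphism G \<phi>) \<longleftrightarrow>
            (\<exists>d. Banach_metric G d \<and>
                 (\<exists>h\<in>mf_boundary G d. finite (Group_Action.orbit G (mf_action G) h)))) \<and>
         ((\<exists>\<psi>. \<psi> \<in> epi G integer_group) \<longrightarrow>
            (\<exists>d. Banach_metric G d \<and>
                 (\<exists>h\<in>mf_boundary G d. \<forall>x\<in>carrier G. mf_action G x h = h)))"
proof -
  interpret group G using assms by (simp add: finitely_generated_group_def)
  obtain S where S: "generated_group G S" using generated_group_exists[OF assms] by blast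
  have "\<exists>d. Banach_metric G d \<and> (\<exists>h\<in>mf_boundary G d. finite (Group_Action.orbit G (mf_action G) h))"
    if \<phi>: "virtual_homomorphism G \<phi>" for \<phi>
  proof -
    obtain H u where H: "subgroup H G" "finite (rcosets\<^bsub>G\<^esub> H)"
      "\<phi> \<in> hom (G\<lparr>carrier := H\<rparr>) integer_group" "u \<in> H" "\<phi> u \<noteq> 0"
      using \<phi> unfolding virtual_homomorphism_def by blast
    show ?thesis
      using finite_cocycle_rcosets[OF S H, THEN finite_cocycle.Banach_metric_d]
        finite_cocycle_rcosets[OF S H, THEN finite_cocycle.h_boundary]
        finite_cocycle_rcosets[OF S H, THEN finite_cocycle.h_orbit] by blast
  qed
  moreover have "\<exists>d. Banach_metric G d \<and> (\<exists>h\<in>mf_boundary G d. \<forall>x\<in>carrier G. mf_action G x h = h)"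
    if \<psi>: "\<psi> \<in> epi G integer_group" for \<psi>
  proof -
    have hom: "\<psi> (x \<otimes>\<^bsub>G\<^esub> y) = \<psi> x + \<psi> y" if "x \<in> carrier G" "y \<in> carrier G" for x y
      using \<psi> that by (auto simp: epi_def hom_def)
    have "1 \<in> \<psi> ` carrier G" using \<psi> by (simp add: epi_def)
    then have nontrivial: "\<exists>x\<in>carrier G. \<psi> x \<noteq> 0" by force
    \<comment> \<open>Over a single point the cocycle identity is the homomorphism law, and every
      group element lies in \<open>N\<close>.\<close>
    have fc: "finite_cocycle G S {()} (\<lambda>_ _. ()) (\<lambda>x _. \<psi> x)"
      by (rule finite_cocycle.intro[OF S], unfold_locales) (simp_all add: hom nontrivial)
    show ?thesis
      using fc[THEN finite_cocycle.Banach_metric_d] fc[THEN finite_cocycle.h_boundary]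
        finite_cocycle.h_fixed[OF fc finite_cocycle.N_I[OF fc]] by blast
  qed
  ultimately show ?thesis using virtual_homomorphism_if_finite_orbit by blast
qed

end
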